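(* Let $A$ and $B$ be closed and convex subsets of a real Hilbert space $\mathcal H$. Assume that $\lambda,\mu>0$, $\lambda\mu<4$ and that $A\cap B\neq\emptyset$. Put $\nu:=\frac{4(\lambda+\mu-\lambda\mu)}{4-\lambda\mu}$ and consider the iterative method $$x^0\in\mathcal H,\qquad x^{k+1}:=x^k+\frac{\alpha_k}{\nu}\Big((P_B)_\mu\big((P_A)_\lambda(x^k)\big)-x^k\Big),\qquad k=0,1,2,\ldots,$$ where $\alpha_k\in[\varepsilon,2-\varepsilon]$ for all $k$ and $\varepsilon>0$. Let $z\in A\cap B$ and let $r:=\|x^0-z\|>0$. The following statements hold: (i) The sequence $\{x^k\}_{k=0}^\infty$ converges weakly to some $x^*\in A\cap B$. (ii) If $\{A,B\}$ is regular over $B(z,r)$, then $\{x^k\}_{k=0}^\infty$ converges in norm to some $x^*\in A\cap B$. (iii) If $\{A,B\}$ is $\kappa$-linearly regular over $B(z,r)$, then $\{x^k\}_{k=0}^\infty$ converges $Q$-linearly to some $x^*\in A\cap B$ at the rate $\sqrt{1-\left(\frac{\varepsilon\delta}{2\nu}\right)^2}$, where $$\delta:=\left(\frac{|\alpha|\min\{\lambda,\mu\}}{2\kappa(1+\beta\sqrt\nu)}\right)^2,\quad \alpha:=\sqrt{\tfrac1\lambda-\tfrac1\nu}-\sqrt{\tfrac1\mu-\tfrac1\nu}\neq0,\quad \beta:=\max\left\{\sqrt{\tfrac1\lambda-\tfrac1\nu},\ \sqrt{\tfrac1\mu-\tfrac1\nu}\right\}>0.$$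
   Context: $P_C$ is the metric projection onto a nonempty closed convex set $C$, and $(P_C)_\lambda:=\operatorname{Id}+\lambda(P_C-\operatorname{Id})$. $B(z,r)$ (with two arguments) is the closed ball with center $z$ and radius $r$; $d(x,C):=\inf_{c\in C}\|x-c\|$. For $\lambda,\mu>0$ with $\lambda\mu<4$ one has $\nu\ge\max\{\lambda,\mu\}>0$, so the square roots in $\alpha,\beta$ are well defined. $Q$-linear convergence of $\{x^k\}$ to $x^*$ at the rate $q$ means that $\|x^{k+1}-x^*\|\le q\,\|x^k-x^*\|$ for $k=0,1,2,\ldots$. Regularity of sets. Let $A,B\subseteq\mathcal H$ be closed and convex with $A\cap B\ne\emptyset$ and $S\subseteq\mathcal H$ nonempty. The pair $\{A,B\}$ is: - regular over $S$ if for every sequence $\{x^k\}\subseteq S$: $\max\{d(x^k,A),d(x^k,B)\}\to0$ implies $d(x^k,A\cap B)\to0$; - $\kappa$-linearly regular over $S$, where $\kappa>0$, if $d(x,A\cap B)\le\kappa\max\{d(x,A),d(x,B)\}$ for all $x\in S$.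
   Formalization: The claim α ≠ 0 is false when λ = μ (then α = 0, e.g. λ = μ = 1), so it is asserted only for λ ≠ μ; (iii) is still proved for all λ, μ, where for λ = μ it gives δ = 0, rate 1 and norm convergence. *)

theory Defs
  imports "HOL-Analysis.Analysis"
begin

(* The library's closest_point requires heine_borel, hence finite dimension;
   here C is a nonempty closed convex subset of an arbitrary Hilbert space. *)
definition metric_proj :: "'a::real_inner set \<Rightarrow> 'a \<Rightarrow> 'a" where
  "metric_proj C x = (THE p. p \<in> C \<and> (\<forall>c\<in>C. norm (x - p) \<le> norm (x - c)))"

definition relaxation :: "real \<Rightarrow> ('a::real_vector \<Rightarrow> 'a) \<Rightarrow> 'a \<Rightarrow> 'a" where
  "relaxation t T x = x + t *\<^sub>R (T x - x)"

definition weakly_converges :: "(nat \<Rightarrow> 'a::real_inner) \<Rightarrow> 'a \<Rightarrow> bool" where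
  "weakly_converges x l \<longleftrightarrow> (\<forall>y. (\<lambda>k. x k \<bullet> y) \<longlonglongrightarrow> l \<bullet> y)"

(* infdist x C is the infimum of dist x c over c in C when C is nonempty
   (and 0 for empty C, a case that does not arise when A and B meet). *)
definition regular_over :: "'a::metric_space set \<Rightarrow> 'a set \<Rightarrow> 'a set \<Rightarrow> bool" where
  "regular_over A B S \<longleftrightarrow>
     (\<forall>x::nat \<Rightarrow> 'a. (\<forall>k. x k \<in> S) \<longrightarrow>
        (\<lambda>k. max (infdist (x k) A) (infdist (x k) B)) \<longlonglongrightarrow> 0 \<longrightarrow>
        (\<lambda>k. infdist (x k) (A \<inter> B)) \<longlonglongrightarrow> 0)"

definition linearly_regular_over ::
  "real \<Rightarrow> 'a::metric_space set \<Rightarrow> 'a set \<Rightarrow> 'a set \<Rightarrow> bool" where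
  "linearly_regular_over \<kappa> A B S \<longleftrightarrow>
     \<kappa> > 0 \<and> (\<forall>x\<in>S. infdist x (A \<inter> B) \<le> \<kappa> * max (infdist x A) (infdist x B))"

(* For q < 1 this estimate entails norm convergence to l; for q = 1 it does not. *)
definition Q_linear_at_rate :: "(nat \<Rightarrow> 'a::real_normed_vector) \<Rightarrow> 'a \<Rightarrow> real \<Rightarrow> bool" where
  "Q_linear_at_rate x l q \<longleftrightarrow> (\<forall>k. norm (x (Suc k) - l) \<le> q * norm (x k - l))"

end

theory Submission
  imports Defs
begin

text \<open>Let \<open>w\<close> be the displacement of the composed relaxed projections at \<open>x\<close>. For every
  \<open>c \<in> A \<inter> B\<close> the product \<open>(c - x) \<bullet> w\<close> dominates \<open>\<parallel>w\<parallel>\<^sup>2 / \<nu>\<close> plus a perfect square,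
  and \<open>\<nu>\<close> is exactly the constant that makes the remainder a perfect square. Writing \<open>e\<^sup>2\<close> for this
  lower bound, the iteration is Fejer monotone with a decrease of order \<open>e\<^sup>2\<close>, and \<open>e\<close> bounds
  the distances to \<open>A\<close> and \<open>B\<close>, so these tend to 0. Weak convergence then follows as in Opial's
  lemma, norm convergence from regularity. In the linearly regular case, Cauchy-Schwarz at the
  projection of \<open>x\<close> onto \<open>A \<inter> B\<close> gives \<open>\<parallel>w\<parallel> \<ge> \<delta> d(x, A \<inter> B)\<close>, and Fejer monotonicity gives
  \<open>\<parallel>x - x\<^sup>*\<parallel> \<le> 2 d(x, A \<inter> B)\<close> for the limit \<open>x\<^sup>*\<close>.\<close>

section \<open>Nested closed convex sets and metric projections\<close>

text \<open>Points of \<open>K n\<close> that nearly minimise the distance to \<open>x\<close> form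
  a Cauchy sequence by the parallelogram law, because these distances increase to a limit. A
  constant \<open>K\<close> yields projections; closed convex hulls of tails yield weak cluster
  points.\<close>

lemma nested_closed_convex_common_point:
  fixes K :: "nat \<Rightarrow> 'a::{real_inner, complete_space} set"
  assumes K: "\<And>n. closed (K n)" "\<And>n. convex (K n)" "\<And>n. K n \<noteq> {}"
    and dec: "decseq K"
    and bd: "\<And>n. infdist x (K n) \<le> M"
  shows "\<exists>p. (\<forall>n. p \<in> K n) \<and> (\<lambda>n. infdist x (K n)) \<longlonglongrightarrow> dist x p"
proof -
  define d where "d = (\<lambda>n. infdist x (K n))"
  have d0: "0 \<le> d n" for n
    by (simp add: d_def infdist_nonneg)
  have "incseq d"
    unfolding incseq_def d_def using dec K(3) by (auto simp: decseq_def intro!: infdist_mono)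
  then obtain D where D: "d \<longlonglongrightarrow> D" "\<And>n. d n \<le> D"
    using incseq_convergent[of d M] bd by (auto simp: d_def)
  have "\<exists>p\<in>K n. dist x p < d n + 1 / Suc n" for n
  proof -
    have "(INF a\<in>K n. dist x a) < d n + 1 / Suc n"
      by (simp add: d_def infdist_notempty[OF K(3)])
    then show ?thesis
      using K(3)[of n] by (subst (asm) cINF_less_iff) auto
  qed
  then obtain p where p: "\<And>n. p n \<in> K n" "\<And>n. dist x (p n) < d n + 1 / Suc n"
    by metis
  \<comment> \<open>The midpoint of \<open>p n\<close> and \<open>p m\<close> lies in
    \<open>K n\<close>, hence at distance at least \<open>d n\<close> from \<open>x\<close>. The
    parallelogram identity then bounds the squared distance of the two points by \<open>h n\<close>,
    uniformly in \<open>m \<ge> n\<close>.\<close>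
  define h where "h = (\<lambda>n. 4 * (D + 1 / Suc n)\<^sup>2 - 4 * (d n)\<^sup>2)"
  have "h \<longlonglongrightarrow> 4 * (D + 0)\<^sup>2 - 4 * D\<^sup>2"
    unfolding h_def by (intro tendsto_intros D(1) LIMSEQ_Suc[OF lim_1_over_n])
  then have h0: "h \<longlonglongrightarrow> 0" by simp
  have close: "(dist (p n) (p m))\<^sup>2 \<le> h n" if "n \<le> m" for n m
  proof -
    have pm: "p m \<in> K n"
      using p(1)[of m] dec that by (auto simp: decseq_def)
    have "midpoint (p n) (p m) \<in> K n"
      using closed_segment_subset[OF p(1) pm K(2)] by auto
    then have "d n \<le> dist x (midpoint (p n) (p m))"
      by (simp add: d_def infdist_le)
    then have "(d n)\<^sup>2 \<le> (dist x (midpoint (p n) (p m)))\<^sup>2"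
      using d0 by (intro power_mono)
    moreover have "(dist (p n) (p m))\<^sup>2 =
        2 * (dist x (p n))\<^sup>2 + 2 * (dist x (p m))\<^sup>2 - 4 * (dist x (midpoint (p n) (p m)))\<^sup>2"
      by (simp add: dist_norm midpoint_def power2_norm_eq_inner inner_simps inner_commute field_simps)
    moreover have "dist x (p n) \<le> D + 1 / Suc n"
      using p(2)[of n] D(2)[of n] by linarith
    then have "(dist x (p n))\<^sup>2 \<le> (D + 1 / Suc n)\<^sup>2"
      by (intro power_mono) auto
    moreover have "1 / real (Suc m) \<le> 1 / Suc n"
      using that by (simp add: frac_le)
    then have "dist x (p m) \<le> D + 1 / Suc n"
      using p(2)[of m] D(2)[of m] by linarith
    then have "(dist x (p m))\<^sup>2 \<le> (D + 1 / Suc n)\<^sup>2"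
      by (intro power_mono) auto
    ultimately show ?thesis
      unfolding h_def by linarith
  qed
  have "Cauchy p"
  proof (rule metric_CauchyI)
    fix e :: real assume e: "e > 0"
    have "\<forall>\<^sub>F n in sequentially. h n < e\<^sup>2"
      using order_tendstoD(2)[OF h0, of "e\<^sup>2"] e by simp
    then obtain N where N: "\<And>n. n \<ge> N \<Longrightarrow> h n < e\<^sup>2"
      by (auto simp: eventually_sequentially)
    have *: "dist (p n) (p m) < e" if "n \<ge> N" "n \<le> m" for n m
      using close[OF that(2)] N[OF that(1)] e power_less_imp_less_base[of "dist (p n) (p m)" 2 e]
      by linarith
    show "\<exists>N. \<forall>m\<ge>N. \<forall>n\<ge>N. dist (p m) (p n) < e"
      using * by (metis dist_commute nat_le_linear)
  qed
  then obtain q where q: "p \<longlonglongrightarrow> q"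
    using Cauchy_convergent convergent_def by blast
  have "q \<in> K n" for n
  proof (rule Lim_in_closed_set[OF K(1)[of n] _ _ q])
    show "\<forall>\<^sub>F m in sequentially. p m \<in> K n"
      using p(1) dec unfolding decseq_def eventually_sequentially by blast
  qed simp
  moreover have "d \<longlonglongrightarrow> dist x q"
  proof -
    have "(\<lambda>n. d n + 1 / Suc n) \<longlonglongrightarrow> D + 0"
      by (intro tendsto_intros D(1) LIMSEQ_Suc[OF lim_1_over_n])
    moreover have "d n \<le> dist x (p n)" "dist x (p n) \<le> d n + 1 / Suc n" for n
      using p[of n] by (auto simp: d_def infdist_le less_imp_le)
    ultimately have "(\<lambda>n. dist x (p n)) \<longlonglongrightarrow> D"
      using real_tendsto_sandwich[OF _ _ D(1), of "\<lambda>n. dist x (p n)" "\<lambda>n. d n + 1 / Suc n"]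
      by simp
    moreover have "(\<lambda>n. dist x (p n)) \<longlonglongrightarrow> dist x q"
      by (intro tendsto_intros q)
    ultimately show ?thesis
      using D(1) LIMSEQ_unique by blast
  qed
  ultimately show ?thesis
    by (auto simp: d_def)
qed

lemma metric_proj_closest:
  fixes C :: "'a::{real_inner, complete_space} set"
  assumes C: "closed C" "convex C" "C \<noteq> {}"
  shows "metric_proj C x \<in> C" "norm (x - metric_proj C x) = infdist x C"
proof -
  \<comment> \<open>For a constant sequence of sets the common point is a nearest point.\<close>
  have "\<exists>p. (\<forall>n::nat. p \<in> C) \<and> (\<lambda>n. infdist x C) \<longlonglongrightarrow> dist x p"
    using C by (intro nested_closed_convex_common_point) (auto simp: decseq_def)
  then obtain p where p: "p \<in> C" "dist x p = infdist x C"
    by (auto simp: LIMSEQ_const_iff)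
  have "metric_proj C x = p"
    unfolding metric_proj_def
  proof (rule the_equality)
    show best: "p \<in> C \<and> (\<forall>c\<in>C. norm (x - p) \<le> norm (x - c))"
      using p infdist_le[of _ C x] by (auto simp: dist_norm)
    show "q = p" if "q \<in> C \<and> (\<forall>c\<in>C. norm (x - q) \<le> norm (x - c))" for q
      using that best any_closest_point_unique[OF C(2,1), of q p x] by (auto simp: dist_norm)
  qed
  then show "metric_proj C x \<in> C" "norm (x - metric_proj C x) = infdist x C"
    using p by (auto simp: dist_norm)
qed

text \<open>The obtuse angle property of the projection, rewritten with \<open>x\<close> as base
  point so that the inequalities for two successive projections can be added.\<close>

lemma metric_proj_cutter:
  fixes C :: "'a::{real_inner, complete_space} set"
  assumes C: "closed C" "convex C" and c: "c \<in> C"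
  shows "(norm (metric_proj C x - x))\<^sup>2 \<le> (c - x) \<bullet> (metric_proj C x - x)"
proof -
  have "C \<noteq> {}" using c by blast
  note P = metric_proj_closest[OF C this, of x]
  have "(x - metric_proj C x) \<bullet> (c - metric_proj C x) \<le> 0"
    using P(2) infdist_le[of _ C x]
    by (intro any_closest_point_dot[OF C(2,1) P(1) c]) (auto simp: dist_norm)
  then show ?thesis
    by (simp add: power2_norm_eq_inner algebra_simps inner_commute)
qed

section \<open>Weak cluster points through closed convex sets\<close>

text \<open>Makes sublevel sets of the distance available as test sets for cluster points. The same
  convex combination of the two projections stays in \<open>C\<close> and is near enough.\<close>

lemma convex_infdist_sublevel:
  fixes C :: "'a::{real_inner, complete_space} set"
  assumes C: "closed C" "convex C" "C \<noteq> {}"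
  shows "convex {y. infdist y C \<le> t}"
proof (rule convexI)
  fix y1 y2 and u v :: real
  assume y: "y1 \<in> {y. infdist y C \<le> t}" "y2 \<in> {y. infdist y C \<le> t}"
    and uv: "0 \<le> u" "0 \<le> v" "u + v = 1"
  let ?P = "metric_proj C"
  have "u *\<^sub>R ?P y1 + v *\<^sub>R ?P y2 \<in> C"
    using metric_proj_closest(1)[OF C] C(2) uv by (simp add: convexD)
  then have "infdist (u *\<^sub>R y1 + v *\<^sub>R y2) C
      \<le> dist (u *\<^sub>R y1 + v *\<^sub>R y2) (u *\<^sub>R ?P y1 + v *\<^sub>R ?P y2)"
    by (rule infdist_le)
  also have "\<dots> = norm (u *\<^sub>R (y1 - ?P y1) + v *\<^sub>R (y2 - ?P y2))"
    by (simp add: dist_norm algebra_simps)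
  also have "\<dots> \<le> u * norm (y1 - ?P y1) + v * norm (y2 - ?P y2)"
    using uv norm_triangle_ineq[of "u *\<^sub>R (y1 - ?P y1)" "v *\<^sub>R (y2 - ?P y2)"] by simp
  also have "\<dots> \<le> u * t + v * t"
    using y uv by (intro add_mono mult_left_mono) (auto simp: metric_proj_closest(2)[OF C])
  also have "\<dots> = t"
    using uv by (metis distrib_right mult_1)
  finally show "u *\<^sub>R y1 + v *\<^sub>R y2 \<in> {y. infdist y C \<le> t}" by simp
qed

text \<open>A substitute for weak sequential compactness of balls: the point \<open>p\<close> plays the role of a
  weak cluster point of \<open>y\<close>.\<close>
lemma bounded_sequence_convex_cluster_point:
  fixes y :: "nat \<Rightarrow> 'a::{real_inner, complete_space}"
  assumes "bounded (range y)"
  obtains p where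
    "\<And>S. closed S \<Longrightarrow> convex S \<Longrightarrow> \<forall>\<^sub>F n in sequentially. y n \<in> S \<Longrightarrow> p \<in> S"
proof -
  \<comment> \<open>A closed convex set containing a tail of \<open>y\<close> contains some
    \<open>K N\<close>, so a point common to all \<open>K n\<close> suffices. Boundedness of
    \<open>y\<close> keeps the \<open>K n\<close> within bounded distance of 0.\<close>
  define K where "K = (\<lambda>n. closure (convex hull (y ` {n..})))"
  obtain M where M: "\<And>n. norm (y n) \<le> M"
    using assms by (auto simp: bounded_iff)
  have mem: "y n \<in> K n" for n
    unfolding K_def by (intro subsetD[OF closure_subset] hull_inc) auto
  have "decseq K"
    unfolding K_def decseq_def by (intro allI impI closure_mono hull_mono image_mono) auto
  moreover have "infdist 0 (K n) \<le> M" for n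
    using infdist_le[OF mem[of n], of 0] M[of n] by simp
  ultimately obtain p where p: "\<And>n. p \<in> K n"
    using nested_closed_convex_common_point[of K 0 M] mem
    by (metis K_def closed_closure convex_closure convex_convex_hull empty_iff)
  have "p \<in> S" if S: "closed S" "convex S" "\<forall>\<^sub>F n in sequentially. y n \<in> S" for S
  proof -
    obtain N where "\<And>n. n \<ge> N \<Longrightarrow> y n \<in> S"
      using S(3) by (auto simp: eventually_sequentially)
    then have "K N \<subseteq> S"
      unfolding K_def using S by (intro closure_minimal hull_minimal) auto
    then show ?thesis using p by blast
  qed
  then show thesis using that by blast
qed

text \<open>Half-spaces are closed and convex, so \<open>p\<close> inherits every eventual bound on
  \<open>y n \<bullet> v\<close>, and such bounds exist arbitrarily close to \<open>L\<close> on
  both sides.\<close>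

lemma convex_cluster_point_inner:
  fixes y :: "nat \<Rightarrow> 'a::real_inner"
  assumes p: "\<And>S. closed S \<Longrightarrow> convex S \<Longrightarrow> \<forall>\<^sub>F n in sequentially. y n \<in> S \<Longrightarrow> p \<in> S"
    and lim: "(\<lambda>n. y n \<bullet> v) \<longlonglongrightarrow> L"
  shows "p \<bullet> v = L"
proof (rule antisym)
  show "p \<bullet> v \<le> L"
  proof (rule dense_ge)
    fix t assume "L < t"
    then have "\<forall>\<^sub>F n in sequentially. y n \<bullet> v < t"
      using lim by (rule order_tendstoD(2)[rotated])
    then have "p \<in> {q. v \<bullet> q \<le> t}"
      by (intro p closed_halfspace_le convex_halfspace_le)
        (auto elim!: eventually_mono simp: inner_commute)
    then show "p \<bullet> v \<le> t" by (simp add: inner_commute)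
  qed
  show "L \<le> p \<bullet> v"
  proof (rule dense_le)
    fix t assume "t < L"
    then have "\<forall>\<^sub>F n in sequentially. t < y n \<bullet> v"
      using lim by (rule order_tendstoD(1)[rotated])
    then have "p \<in> {q. v \<bullet> q \<ge> t}"
      by (intro p closed_halfspace_ge convex_halfspace_ge)
        (auto elim!: eventually_mono simp: inner_commute)
    then show "t \<le> p \<bullet> v" by (simp add: inner_commute)
  qed
qed

section \<open>Convergence of Fejer monotone sequences\<close>

definition fejer_monotone :: "'a::metric_space set \<Rightarrow> (nat \<Rightarrow> 'a) \<Rightarrow> bool" where
  "fejer_monotone C x \<longleftrightarrow> (\<forall>c\<in>C. decseq (\<lambda>k. dist (x k) c))"

lemma fejer_monotone_convergent_dist:
  assumes "fejer_monotone C x" "c \<in> C"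
  shows "convergent (\<lambda>k. dist (x k) c)"
  using assms
  by (auto simp: fejer_monotone_def convergent_def intro: decseq_convergent[of "\<lambda>k. dist (x k) c" 0])

lemma fejer_monotone_bounded:
  fixes x :: "nat \<Rightarrow> 'a::metric_space"
  assumes "fejer_monotone C x" "c \<in> C"
  shows "bounded (range x)"
  unfolding bounded_any_center[of _ c]
  using assms by (auto simp: fejer_monotone_def decseq_def dist_commute intro!: exI[of _ "dist (x 0) c"])

text \<open>Opial's argument: vanishing distances place every cluster point in both sets, and Fejer
  monotonicity leaves room for only one.\<close>

lemma fejer_monotone_weakly_converges:
  fixes A B :: "'a::{real_inner, complete_space} set"
  assumes A: "closed A" "convex A" and B: "closed B" "convex B" and ne: "A \<inter> B \<noteq> {}"
    and fej: "fejer_monotone (A \<inter> B) x"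
    and dA: "(\<lambda>k. infdist (x k) A) \<longlonglongrightarrow> 0" and dB: "(\<lambda>k. infdist (x k) B) \<longlonglongrightarrow> 0"
  shows "\<exists>xs\<in>A \<inter> B. weakly_converges x xs"
proof -
  have bdd: "bounded (range x)"
    using ne fej fejer_monotone_bounded by blast
  have in_limit: "p \<in> E"
    if E: "closed E" "convex E" "E \<noteq> {}" "(\<lambda>k. infdist (x k) E) \<longlonglongrightarrow> 0" and f: "strict_mono f"
      and p: "\<And>S. closed S \<Longrightarrow> convex S \<Longrightarrow> \<forall>\<^sub>F n in sequentially. x (f n) \<in> S \<Longrightarrow> p \<in> S"
    for E f p
  proof -
    have "infdist p E \<le> 0"
    proof (rule dense_ge)
      fix t :: real assume "0 < t"
      then have "\<forall>\<^sub>F n in sequentially. infdist (x (f n)) E < t"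
        using LIMSEQ_subseq_LIMSEQ[OF E(4) f] by (auto dest: order_tendstoD simp: o_def)
      moreover have "closed {y. infdist y E \<le> t}"
        by (intro closed_Collect_le continuous_intros)
      ultimately have "p \<in> {y. infdist y E \<le> t}"
        by (intro p convex_infdist_sublevel E(1-3)) (auto elim!: eventually_mono)
      then show "infdist p E \<le> t" by simp
    qed
    then show ?thesis
      using in_closed_iff_infdist_zero[OF E(1,3)] infdist_nonneg[of p E] by auto
  qed
  have in_AB: "p \<in> A \<inter> B"
    if "strict_mono f"
      "\<And>S. closed S \<Longrightarrow> convex S \<Longrightarrow> \<forall>\<^sub>F n in sequentially. x (f n) \<in> S \<Longrightarrow> p \<in> S" for f p
    using in_limit[OF A _ dA that] in_limit[OF B _ dB that] ne by blast
  \<comment> \<open>Up to a constant this inner product is half a difference of two squared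
    distances, both of which converge.\<close>
  have lim_diff: "convergent (\<lambda>k. x k \<bullet> (p - q))" if pq: "p \<in> A \<inter> B" "q \<in> A \<inter> B" for p q
  proof -
    have "(\<lambda>k. x k \<bullet> (p - q)) =
        (\<lambda>k. ((dist (x k) q)\<^sup>2 - (dist (x k) p)\<^sup>2 + p \<bullet> p - q \<bullet> q) * (1 / 2))"
      by (simp add: dist_norm power2_norm_eq_inner inner_simps inner_commute fun_eq_iff)
    moreover obtain L M where
      "(\<lambda>k. dist (x k) p) \<longlonglongrightarrow> L" "(\<lambda>k. dist (x k) q) \<longlonglongrightarrow> M"
      using fejer_monotone_convergent_dist[OF fej pq(1)] fejer_monotone_convergent_dist[OF fej pq(2)]
      by (auto simp: convergent_def)
    then have "(\<lambda>k. ((dist (x k) q)\<^sup>2 - (dist (x k) p)\<^sup>2 + p \<bullet> p - q \<bullet> q) * (1 / 2))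
        \<longlonglongrightarrow> (M\<^sup>2 - L\<^sup>2 + p \<bullet> p - q \<bullet> q) * (1 / 2)"
      by (intro tendsto_intros)
    ultimately show ?thesis unfolding convergent_def by metis
  qed
  obtain xs where xs: "\<And>S. closed S \<Longrightarrow> convex S \<Longrightarrow> \<forall>\<^sub>F n in sequentially. x n \<in> S \<Longrightarrow> xs \<in> S"
    using bounded_sequence_convex_cluster_point[OF bdd] by blast
  have xs_AB: "xs \<in> A \<inter> B"
    using in_AB[OF strict_mono_id, of xs] xs by simp
  \<comment> \<open>Otherwise a subsequence stays in the half-space at height
    \<open>xs \<bullet> v + t\<close>, and so does its cluster point \<open>p\<close>. But the inner
    products with \<open>p - xs\<close> converge along the whole sequence, so \<open>p\<close> and
    \<open>xs\<close> have the same product with \<open>p - xs\<close>, whence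
    \<open>p = xs\<close>.\<close>
  have halfspace: "\<forall>\<^sub>F k in sequentially. x k \<bullet> v < xs \<bullet> v + t" if t: "t > 0" for v t
  proof (rule ccontr)
    assume "\<not> ?thesis"
    then have "\<exists>\<^sub>F k in sequentially. x k \<bullet> v \<ge> xs \<bullet> v + t"
      by (simp add: frequently_def not_le)
    then have "infinite {k. x k \<bullet> v \<ge> xs \<bullet> v + t}"
      by (simp add: frequently_cofinite flip: cofinite_eq_sequentially)
    from infinite_enumerate[OF this] obtain f :: "nat \<Rightarrow> nat"
      where f: "strict_mono f" "\<And>n. x (f n) \<bullet> v \<ge> xs \<bullet> v + t"
      by auto
    have "bounded (range (\<lambda>n. x (f n)))"
      using bdd by (rule bounded_subset) auto
    then obtain p where
      p: "\<And>S. closed S \<Longrightarrow> convex S \<Longrightarrow> \<forall>\<^sub>F n in sequentially. x (f n) \<in> S \<Longrightarrow> p \<in> S"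
      using bounded_sequence_convex_cluster_point by blast
    have p_AB: "p \<in> A \<inter> B" using in_AB[OF f(1) p] .
    obtain L where L: "(\<lambda>k. x k \<bullet> (p - xs)) \<longlonglongrightarrow> L"
      using lim_diff[OF p_AB xs_AB] by (auto simp: convergent_def)
    have "xs \<bullet> (p - xs) = L"
      by (rule convex_cluster_point_inner[OF xs L])
    moreover have "p \<bullet> (p - xs) = L"
      using LIMSEQ_subseq_LIMSEQ[OF L f(1)]
      by (intro convex_cluster_point_inner[OF p]) (auto simp: o_def)
    ultimately have "p = xs"
      by (metis eq_iff_diff_eq_0 inner_diff_left inner_eq_zero_iff)
    moreover have "p \<in> {q. v \<bullet> q \<ge> xs \<bullet> v + t}"
      using f(2) by (intro p closed_halfspace_ge convex_halfspace_ge) (auto simp: inner_commute)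
    ultimately show False using t by (simp add: inner_commute)
  qed
  have "(\<lambda>k. x k \<bullet> v) \<longlonglongrightarrow> xs \<bullet> v" for v
  proof (rule order_tendstoI)
    show "\<forall>\<^sub>F k in sequentially. x k \<bullet> v < t" if "xs \<bullet> v < t" for t
      using halfspace[of "t - xs \<bullet> v" v] that by simp
    show "\<forall>\<^sub>F k in sequentially. t < x k \<bullet> v" if "t < xs \<bullet> v" for t
      using halfspace[of "xs \<bullet> v - t" "- v"] that by simp
  qed
  then show ?thesis
    using xs_AB by (auto simp: weakly_converges_def)
qed

text \<open>After index \<open>k\<close> the sequence stays within \<open>dist (x k) c\<close> of
  each \<open>c\<close> in \<open>C\<close>. The triangle inequality through \<open>c\<close>, with
  the infimum over \<open>c\<close>, gives the Cauchy property and, in the limit, the factor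
  2.\<close>

lemma fejer_monotone_converges:
  fixes C :: "'a::complete_space set"
  assumes C: "closed C" "C \<noteq> {}" and fej: "fejer_monotone C x"
    and dC: "(\<lambda>k. infdist (x k) C) \<longlonglongrightarrow> 0"
  shows "\<exists>xs\<in>C. x \<longlonglongrightarrow> xs \<and> (\<forall>k. dist (x k) xs \<le> 2 * infdist (x k) C)"
proof -
  have step: "dist (x m) (x k) \<le> 2 * infdist (x k) C" if "k \<le> m" for k m
  proof -
    have "dist (x m) (x k) / 2 \<le> dist (x k) c" if "c \<in> C" for c
    proof -
      have "dist (x m) c \<le> dist (x k) c"
        using fej \<open>c \<in> C\<close> \<open>k \<le> m\<close> by (auto simp: fejer_monotone_def decseq_def)
      then show ?thesis
        using dist_triangle2[of "x m" "x k" c] by simp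
    qed
    then have "dist (x m) (x k) / 2 \<le> infdist (x k) C"
      unfolding infdist_notempty[OF C(2)] by (intro cINF_greatest C(2))
    then show ?thesis by simp
  qed
  have "Cauchy x"
  proof (rule metric_CauchyI)
    fix e :: real assume "e > 0"
    then have "\<forall>\<^sub>F k in sequentially. infdist (x k) C < e / 4"
      by (intro order_tendstoD(2)[OF dC]) simp
    then obtain N where N: "infdist (x N) C < e / 4"
      using eventually_happens' sequentially_bot by blast
    have "dist (x m) (x n) < e" if "m \<ge> N" "n \<ge> N" for m n
      using step[OF that(1)] step[OF that(2)] N dist_triangle2[of "x m" "x n" "x N"] by linarith
    then show "\<exists>N. \<forall>m\<ge>N. \<forall>n\<ge>N. dist (x m) (x n) < e" by blast
  qed
  then obtain xs where xs: "x \<longlonglongrightarrow> xs"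
    using Cauchy_convergent convergent_def by blast
  have "infdist xs C = 0"
    using LIMSEQ_unique[OF tendsto_infdist[OF xs] dC] .
  then have "xs \<in> C"
    using in_closed_iff_infdist_zero[OF C] by blast
  moreover have "dist (x k) xs \<le> 2 * infdist (x k) C" for k
  proof (rule LIMSEQ_le_const2)
    show "(\<lambda>m. dist (x k) (x m)) \<longlonglongrightarrow> dist (x k) xs"
      by (intro tendsto_intros xs)
    show "\<exists>N. \<forall>m\<ge>N. dist (x k) (x m) \<le> 2 * infdist (x k) C"
      using step by (metis dist_commute)
  qed
  ultimately show ?thesis using xs by blast
qed

section \<open>Relaxation parameters and the one-step estimate\<close>

text \<open>\<open>n - l\<close> and \<open>n - m\<close> are nonnegative multiples of squares. The
  third claim is the defining equation of \<open>n\<close> cleared of denominators; it states that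
  the quadratic form with coefficients \<open>1 / l - 1 / n\<close>, \<open>1 / m - 1 / n\<close>
  and mixed coefficient \<open>1 - 2 / n\<close> has discriminant zero.\<close>

lemma relaxation_parameters:
  fixes l m n :: real
  assumes l: "l > 0" and m: "m > 0" and lm: "l * m < 4"
    and n: "n = 4 * (l + m - l * m) / (4 - l * m)"
  shows "l \<le> n" "m \<le> n" "4 * (1 / l - 1 / n) * (1 / m - 1 / n) = (1 - 2 / n)\<^sup>2"
    "1 - 2 / n \<ge> 0 \<longleftrightarrow> (l - 2) * (m - 2) \<le> 0"
proof -
  have p: "4 - l * m > 0" using lm by simp
  have "n - l = m * (2 - l)\<^sup>2 / (4 - l * m)" "n - m = l * (2 - m)\<^sup>2 / (4 - l * m)"
    unfolding n using p by (simp_all add: field_simps power2_eq_square)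
  moreover have "m * (2 - l)\<^sup>2 / (4 - l * m) \<ge> 0" "l * (2 - m)\<^sup>2 / (4 - l * m) \<ge> 0"
    using l m p by simp_all
  ultimately show ln: "l \<le> n" and "m \<le> n" by simp_all
  have n0: "n > 0" using ln l by simp
  have nn: "n * (4 - l * m) = 4 * (l + m - l * m)"
    unfolding n using p by simp
  have "4 * (1 / l - 1 / n) * (1 / m - 1 / n) - (1 - 2 / n)\<^sup>2 =
      (n * (4 - l * m) - 4 * (l + m - l * m)) / (n * l * m)"
    using l m n0 by (simp add: field_simps power2_eq_square)
  then show "4 * (1 / l - 1 / n) * (1 / m - 1 / n) = (1 - 2 / n)\<^sup>2"
    using nn by simp
  have "(n - 2) * (4 - l * m) = - 2 * ((l - 2) * (m - 2))"
    using nn by (simp add: algebra_simps)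
  then have "n - 2 \<ge> 0 \<longleftrightarrow> (l - 2) * (m - 2) \<le> 0"
    using p by (smt (verit) mult_less_0_iff zero_le_mult_iff)
  then show "1 - 2 / n \<ge> 0 \<longleftrightarrow> (l - 2) * (m - 2) \<le> 0"
    using n0 by (simp add: field_simps)
qed

text \<open>The number \<open>\<tau>\<close> is \<open>t\<close> up to a sign, chosen so that the mixed term in the square of
  \<open>s a + \<tau> b\<close> is \<open>(1 - 2/n) (a \<bullet> b)\<close>; it is negative when \<open>l\<close> and \<open>m\<close> lie on the same side of 2.\<close>
lemma relaxation_parameters_sqrt:
  fixes l m n :: real
  assumes l: "l > 0" and m: "m > 0" and lm: "l * m < 4"
    and n: "n = 4 * (l + m - l * m) / (4 - l * m)"
  defines "s \<equiv> sqrt (1 / l - 1 / n)" and "t \<equiv> sqrt (1 / m - 1 / n)"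
  shows "0 \<le> s" "0 \<le> t" "s\<^sup>2 = 1 / l - 1 / n" "t\<^sup>2 = 1 / m - 1 / n" "max s t > 0"
    "\<exists>\<tau>. \<bar>\<tau>\<bar> = t \<and> 2 * s * \<tau> = 1 - 2 / n \<and> s \<noteq> \<tau>"
proof -
  note P = relaxation_parameters[OF l m lm n]
  have "0 \<le> 1 / l - 1 / n" "0 \<le> 1 / m - 1 / n"
    using P(1,2) l m by (simp_all add: frac_le)
  then show s0: "0 \<le> s" and t0: "0 \<le> t"
    and s2: "s\<^sup>2 = 1 / l - 1 / n" and t2: "t\<^sup>2 = 1 / m - 1 / n"
    by (simp_all add: s_def t_def)
  have st: "2 * s * t = \<bar>1 - 2 / n\<bar>"
  proof (rule power2_eq_imp_eq)
    show "(2 * s * t)\<^sup>2 = \<bar>1 - 2 / n\<bar>\<^sup>2"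
      using P(3) by (simp add: power_mult_distrib s2 t2)
  qed (use s0 t0 in auto)
  have eqD: "l = m" if "s = t"
    using that s2 t2 by simp
  \<comment> \<open>If both vanished, then \<open>l = m = n\<close>, and \<open>st\<close> would
    give \<open>n = 2\<close>, against \<open>l * m < 4\<close>.\<close>
  have not_both: "\<not> (s = 0 \<and> t = 0)"
  proof
    assume "s = 0 \<and> t = 0"
    moreover from this have "l = m" using eqD by simp
    ultimately have "1 / l - 1 / n = 0" "1 - 2 / n = 0"
      using s2 st by auto
    then have "n = 2" "l = 2" "m = 2"
      using l \<open>l = m\<close> by (auto simp: field_simps)
    then show False using lm by simp
  qed
  then show "max s t > 0"
    using s0 t0 by (auto simp: max_def)
  show "\<exists>\<tau>. \<bar>\<tau>\<bar> = t \<and> 2 * s * \<tau> = 1 - 2 / n \<and> s \<noteq> \<tau>"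
  proof (cases "1 - 2 / n \<ge> 0")
    case True
    \<comment> \<open>Equality gives \<open>l = m\<close>, and the sign of \<open>1 - 2 / n\<close>
      then forces both to be 2. In the other case \<open>s = - t\<close> would make both roots
      vanish.\<close>
    have "s \<noteq> t"
    proof
      assume "s = t"
      then have "l = m" by (rule eqD)
      moreover from this have "(m - 2) * (m - 2) \<le> 0" using P(4) True by simp
      ultimately have "l = 2 \<and> m = 2"
        by (metis eq_iff_diff_eq_0 mult_eq_0_iff order_antisym zero_le_square)
      then show False using lm by simp
    qed
    then show ?thesis using st True t0 by (intro exI[of _ t]) auto
  next
    case False
    then show ?thesis using st t0 s0 not_both by (intro exI[of _ "- t"]) auto
  qed
qed

text \<open>Both projections are cutters, so with \<open>a = l u\<close>, \<open>b = m v\<close> and \<open>w = a + b\<close> the inner product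
  \<open>(c - x) \<bullet> w\<close> exceeds \<open>\<parallel>w\<parallel>\<^sup>2 / n\<close> by the perfect square \<open>\<parallel>s a + \<tau> b\<parallel>\<^sup>2\<close>; together the two
  terms control \<open>a\<close> and \<open>b\<close> separately because \<open>s \<noteq> \<tau>\<close>.\<close>
lemma relaxed_projections_residual:
  fixes A B :: "'a::{real_inner, complete_space} set"
    and x :: 'a
  assumes A: "closed A" "convex A" and B: "closed B" "convex B" and ne: "A \<inter> B \<noteq> {}"
    and l: "l > 0" and m: "m > 0" and min2: "min l m \<le> 2" and n: "n > 0"
    and s: "s\<^sup>2 = 1 / l - 1 / n" and tau: "\<tau>\<^sup>2 = 1 / m - 1 / n" and stau: "2 * s * \<tau> = 1 - 2 / n"
    and \<beta>: "\<bar>s\<bar> \<le> \<beta>" "\<bar>\<tau>\<bar> \<le> \<beta>"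
    and \<gamma>: "0 \<le> \<gamma>" "\<gamma> \<le> \<bar>s - \<tau>\<bar>" "\<gamma> \<le> \<beta>"
  defines "w \<equiv> relaxation m (metric_proj B) (relaxation l (metric_proj A) x) - x"
  shows "\<exists>e\<ge>0. (\<forall>c\<in>A \<inter> B. e\<^sup>2 \<le> (c - x) \<bullet> w) \<and> norm w \<le> sqrt n * e \<and>
    \<gamma> * min l m * max (infdist x A) (infdist x B) \<le> 2 * (1 + \<beta> * sqrt n) * e"
proof -
  define u where "u = metric_proj A x - x"
  define y where "y = x + l *\<^sub>R u"
  define v where "v = metric_proj B y - y"
  define a where "a = l *\<^sub>R u"
  define b where "b = m *\<^sub>R v"
  have w: "w = a + b"
    by (simp add: w_def relaxation_def a_def b_def v_def y_def u_def)
  define e where "e = sqrt ((norm w)\<^sup>2 / n + (norm (s *\<^sub>R a + \<tau> *\<^sub>R b))\<^sup>2)"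
  have e0: "0 \<le> e" and e2: "e\<^sup>2 = (norm w)\<^sup>2 / n + (norm (s *\<^sub>R a + \<tau> *\<^sub>R b))\<^sup>2"
    using n by (simp_all add: e_def)
  \<comment> \<open>The mixed coefficient \<open>2 / n + 2 * s * \<tau>\<close> equals 1 and the
    others become \<open>1 / l\<close> and \<open>1 / m\<close>: exactly the sum that the two cutter
    inequalities produce.\<close>
  have square: "e\<^sup>2 = (norm a)\<^sup>2 / l + (norm b)\<^sup>2 / m + a \<bullet> b"
  proof -
    have "e\<^sup>2 = (1 / n + s\<^sup>2) * (a \<bullet> a) + (1 / n + \<tau>\<^sup>2) * (b \<bullet> b) + (2 / n + 2 * s * \<tau>) * (a \<bullet> b)"
      unfolding e2 w power2_norm_eq_inner
      by (simp add: inner_simps inner_commute algebra_simps power2_eq_square add_divide_distrib)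
    then show ?thesis
      unfolding s tau stau by (simp add: power2_norm_eq_inner)
  qed
  have cutter: "e\<^sup>2 \<le> (c - x) \<bullet> w" if c: "c \<in> A \<inter> B" for c
  proof -
    have "(norm u)\<^sup>2 \<le> (c - x) \<bullet> u" "(norm v)\<^sup>2 \<le> (c - y) \<bullet> v"
      unfolding u_def v_def using metric_proj_cutter A B c by blast+
    then have "l * (norm u)\<^sup>2 \<le> l * ((c - x) \<bullet> u)" "m * (norm v)\<^sup>2 \<le> m * ((c - y) \<bullet> v)"
      using l m by (simp_all add: mult_left_mono)
    moreover have "(norm a)\<^sup>2 / l = l * (norm u)\<^sup>2" "(norm b)\<^sup>2 / m = m * (norm v)\<^sup>2"
      using l m by (simp_all add: a_def b_def power_mult_distrib power2_eq_square)
    \<comment> \<open>The second cutter inequality is based at \<open>y = x + a\<close>; moving its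
      base point back to \<open>x\<close> creates the term \<open>a \<bullet> b\<close>.\<close>
    moreover have "(c - x) \<bullet> w = l * ((c - x) \<bullet> u) + m * ((c - y) \<bullet> v) + a \<bullet> b"
      by (simp add: w a_def b_def y_def inner_simps algebra_simps)
    ultimately show ?thesis
      unfolding square by linarith
  qed
  have "((norm w) / sqrt n)\<^sup>2 \<le> e\<^sup>2"
    unfolding e2 using n by (simp add: power_divide)
  then have "norm w / sqrt n \<le> e"
    using e0 by (rule power2_le_imp_le)
  then have we: "norm w \<le> sqrt n * e"
    using n by (simp add: field_simps)
  have "(norm (s *\<^sub>R a + \<tau> *\<^sub>R b))\<^sup>2 \<le> e\<^sup>2"
    unfolding e2 using n by simp
  then have de: "norm (s *\<^sub>R a + \<tau> *\<^sub>R b) \<le> e"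
    using e0 by (rule power2_le_imp_le)
  define R where "R = (1 + \<beta> * sqrt n) * e"
  have \<beta>0: "0 \<le> \<beta>" using \<beta> by linarith
  have R0: "0 \<le> R"
    unfolding R_def using \<beta>0 e0 n by simp
  \<comment> \<open>Subtracting \<open>\<rho> *\<^sub>R w\<close> with
    \<open>\<rho> = \<tau>\<close> removes \<open>b\<close>, with \<open>\<rho> = s\<close> removes
    \<open>a\<close>; the remaining coefficient is \<open>s - \<tau>\<close> up to sign.\<close>
  have combine: "norm (s *\<^sub>R a + \<tau> *\<^sub>R b - \<rho> *\<^sub>R w) \<le> R" if "\<bar>\<rho>\<bar> \<le> \<beta>" for \<rho>
  proof -
    have "norm (s *\<^sub>R a + \<tau> *\<^sub>R b - \<rho> *\<^sub>R w) \<le> e + \<bar>\<rho>\<bar> * norm w"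
      using norm_triangle_ineq4[of "s *\<^sub>R a + \<tau> *\<^sub>R b" "\<rho> *\<^sub>R w"] de by simp
    also have "\<dots> \<le> e + \<beta> * (sqrt n * e)"
      using that we \<beta>0 by (intro add_left_mono mult_mono) auto
    finally show ?thesis by (simp add: R_def algebra_simps)
  qed
  have "s *\<^sub>R a + \<tau> *\<^sub>R b - \<tau> *\<^sub>R w = (s - \<tau>) *\<^sub>R a" "s *\<^sub>R a + \<tau> *\<^sub>R b - s *\<^sub>R w = (\<tau> - s) *\<^sub>R b"
    by (simp_all add: w algebra_simps)
  then have "\<bar>s - \<tau>\<bar> * norm a \<le> R" "\<bar>s - \<tau>\<bar> * norm b \<le> R"
    using combine[OF \<beta>(2)] combine[OF \<beta>(1)] by (simp_all add: abs_minus_commute)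
  then have ga: "\<gamma> * norm a \<le> R" and gb: "\<gamma> * norm b \<le> R"
    using \<gamma>(2) by (meson mult_right_mono norm_ge_zero order_trans)+
  have "\<gamma> * norm w \<le> \<beta> * (sqrt n * e)"
    using \<gamma> we \<beta>0 by (intro mult_mono) auto
  then have gw: "\<gamma> * norm w \<le> R"
    using e0 by (simp add: R_def algebra_simps)
  have ab: "A \<noteq> {}" "B \<noteq> {}" using ne by auto
  have "infdist x A = norm u"
    using metric_proj_closest(2)[OF A ab(1), of x] by (simp add: u_def norm_minus_commute)
  then have "l * infdist x A = norm a"
    using l by (simp add: a_def)
  then have "\<gamma> * l * infdist x A \<le> R"
    using ga by (simp add: mult.assoc)
  moreover have "\<gamma> * min l m * infdist x A \<le> \<gamma> * l * infdist x A"
    using \<gamma>(1) by (intro mult_right_mono mult_left_mono infdist_nonneg) auto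
  ultimately have dA: "\<gamma> * min l m * infdist x A \<le> 2 * R"
    using R0 by linarith
  have "x - metric_proj B y = - (a + v)"
    by (simp add: v_def y_def a_def)
  then have dB_le: "infdist x B \<le> norm (a + v)"
    using infdist_le[OF metric_proj_closest(1)[OF B ab(2)], of x y]
    by (simp add: dist_norm norm_minus_cancel del: minus_add_distrib)
  \<comment> \<open>Here \<open>m *\<^sub>R (a + v)\<close> equals \<open>m *\<^sub>R a + b\<close>.
    For \<open>m \<ge> 1\<close> it is split as \<open>(m - 1) *\<^sub>R a + w\<close>, which gives
    the bound \<open>R\<close> for \<open>\<gamma> * norm (a + v)\<close>, and
    \<open>min l m \<le> 2\<close> supplies the factor 2. For \<open>m < 1\<close> the triangle
    inequality gives \<open>R + R\<close>.\<close>
  have dB: "\<gamma> * min l m * infdist x B \<le> 2 * R"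
  proof (cases "m \<ge> 1")
    case True
    have "m *\<^sub>R (a + v) = (m - 1) *\<^sub>R a + w"
      by (simp add: w b_def algebra_simps)
    then have "m * norm (a + v) \<le> (m - 1) * norm a + norm w"
      using norm_triangle_ineq[of "(m - 1) *\<^sub>R a" w] True
      by (metis abs_of_nonneg diff_ge_0_iff_ge m less_imp_le norm_scaleR)
    then have "\<gamma> * (m * norm (a + v)) \<le> (m - 1) * (\<gamma> * norm a) + \<gamma> * norm w"
      using mult_left_mono[OF _ \<gamma>(1)] by (fastforce simp: algebra_simps)
    also have "\<dots> \<le> (m - 1) * R + R"
      using ga gw True by (intro add_mono mult_left_mono) auto
    finally have "m * (\<gamma> * norm (a + v)) \<le> m * R"
      by (simp add: algebra_simps)
    then have "\<gamma> * norm (a + v) \<le> R" using m by simp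
    then have "\<gamma> * infdist x B \<le> R"
      using dB_le \<gamma>(1) by (meson mult_left_mono order_trans)
    then have "min l m * (\<gamma> * infdist x B) \<le> 2 * R"
      using min2 \<gamma>(1) l m by (intro mult_mono) (auto simp: infdist_nonneg)
    then show ?thesis by (simp add: ac_simps)
  next
    case False
    have "min l m * norm (a + v) \<le> m * norm (a + v)"
      by (intro mult_right_mono) auto
    also have "\<dots> \<le> m * norm a + norm b"
      using norm_triangle_ineq[of a v] m by (simp add: b_def flip: distrib_left)
    also have "\<dots> \<le> norm a + norm b"
      using False m mult_right_mono[of m 1 "norm a"] by simp
    finally have "\<gamma> * (min l m * norm (a + v)) \<le> \<gamma> * norm a + \<gamma> * norm b"
      using \<gamma>(1) by (metis distrib_left mult_left_mono)
    moreover have "\<gamma> * (min l m * infdist x B) \<le> \<gamma> * (min l m * norm (a + v))"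
      using dB_le \<gamma>(1) l m by (intro mult_left_mono) auto
    ultimately show ?thesis
      using ga gb by (simp add: mult.assoc)
  qed
  have "\<gamma> * min l m * max (infdist x A) (infdist x B) \<le> 2 * R"
    using dA dB by (simp add: max_def)
  then show ?thesis
    using e0 cutter we by (intro exI[of _ e]) (simp add: R_def algebra_simps)
qed

text \<open>Expanding the square leaves a decrease of at least
  \<open>a * (2 - a) * (e\<^sup>2 / n)\<close>, and both \<open>a\<close> and \<open>2 - a\<close>
  are at least \<open>\<epsilon>\<close>.\<close>

lemma relaxed_step_decrease:
  fixes x w c :: "'a::real_inner"
  assumes n: "n > 0" and \<epsilon>: "\<epsilon> > 0" and a: "a \<in> {\<epsilon>..2 - \<epsilon>}"
    and e: "e\<^sup>2 \<le> (c - x) \<bullet> w" and w: "(norm w)\<^sup>2 \<le> n * e\<^sup>2"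
  shows "(norm (x + (a / n) *\<^sub>R w - c))\<^sup>2 \<le> (norm (x - c))\<^sup>2 - \<epsilon>\<^sup>2 / n * e\<^sup>2"
proof -
  have "(norm (x + (a / n) *\<^sub>R w - c))\<^sup>2 =
      (norm (x - c))\<^sup>2 - 2 * (a / n) * ((c - x) \<bullet> w) + (a / n)\<^sup>2 * (norm w)\<^sup>2"
    unfolding power2_norm_eq_inner
    by (simp add: power2_eq_square inner_simps inner_commute algebra_simps diff_divide_distrib)
  also have "\<dots> \<le> (norm (x - c))\<^sup>2 - 2 * (a / n) * e\<^sup>2 + (a / n)\<^sup>2 * (n * e\<^sup>2)"
    using e w n a \<epsilon> by (intro add_mono diff_left_mono mult_left_mono) auto
  also have "\<dots> = (norm (x - c))\<^sup>2 - a * (2 - a) * (e\<^sup>2 / n)"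
    using n by (simp add: power2_eq_square field_simps)
  also have "\<dots> \<le> (norm (x - c))\<^sup>2 - \<epsilon> * \<epsilon> * (e\<^sup>2 / n)"
    using n a \<epsilon> by (intro diff_left_mono mult_right_mono mult_mono) auto
  finally show ?thesis
    by (simp add: power2_eq_square)
qed

section \<open>Convergence of the relaxed iteration\<close>

theorem corollary4p3:
  fixes A B :: "'a::{real_inner, complete_space} set"
    and lam \<mu> \<nu> \<epsilon> r \<kappa> \<alpha> \<beta> \<delta> :: real
    and a :: "nat \<Rightarrow> real"
    and x :: "nat \<Rightarrow> 'a"
    and z :: 'a
  assumes "closed A" "convex A" "closed B" "convex B"
    and "lam > 0" "\<mu> > 0" "lam * \<mu> < 4"
    and "A \<inter> B \<noteq> {}"
    and "\<nu> = 4 * (lam + \<mu> - lam * \<mu>) / (4 - lam * \<mu>)"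
    and "\<And>k. x (Suc k) = x k + (a k / \<nu>) *\<^sub>R
           (relaxation \<mu> (metric_proj B) (relaxation lam (metric_proj A) (x k)) - x k)"
    and "\<epsilon> > 0"
    and "\<And>k. a k \<in> {\<epsilon>..2 - \<epsilon>}"
    and "z \<in> A \<inter> B"
    and "r = norm (x 0 - z)" "r > 0"
    and "\<alpha> = sqrt (1 / lam - 1 / \<nu>) - sqrt (1 / \<mu> - 1 / \<nu>)"
    and "\<beta> = max (sqrt (1 / lam - 1 / \<nu>)) (sqrt (1 / \<mu> - 1 / \<nu>))"
    and "\<delta> = (\<bar>\<alpha>\<bar> * min lam \<mu> / (2 * \<kappa> * (1 + \<beta> * sqrt \<nu>)))\<^sup>2"
  shows "(\<exists>xs \<in> A \<inter> B. weakly_converges x xs) \<and>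
         (regular_over A B (cball z r) \<longrightarrow> (\<exists>xs \<in> A \<inter> B. x \<longlonglongrightarrow> xs)) \<and>
         (linearly_regular_over \<kappa> A B (cball z r) \<longrightarrow>
            (\<exists>xs \<in> A \<inter> B. x \<longlonglongrightarrow> xs \<and>
               Q_linear_at_rate x xs (sqrt (1 - (\<epsilon> * \<delta> / (2 * \<nu>))\<^sup>2)))) \<and>
         (lam \<noteq> \<mu> \<longrightarrow> \<alpha> \<noteq> 0) \<and> \<beta> > 0"
proof -
  note l = assms(5) and m = assms(6) and lm = assms(7) and ne = assms(8) and \<nu> = assms(9)
  define s where "s = sqrt (1 / lam - 1 / \<nu>)"
  define t where "t = sqrt (1 / \<mu> - 1 / \<nu>)"
  note Q = relaxation_parameters_sqrt[OF l m lm \<nu>, folded s_def t_def]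
  obtain \<tau> where \<tau>: "\<bar>\<tau>\<bar> = t" "2 * s * \<tau> = 1 - 2 / \<nu>" "s \<noteq> \<tau>"
    using Q(6) by blast
  have \<alpha>: "\<alpha> = s - t" and \<beta>: "\<beta> = max s t"
    using assms by (simp_all add: s_def t_def)
  have \<nu>0: "\<nu> > 0"
    using relaxation_parameters(1)[OF l m lm \<nu>] l by linarith
  have \<tau>2: "\<tau>\<^sup>2 = 1 / \<mu> - 1 / \<nu>"
    using Q(4) \<tau>(1) by (metis power2_abs)
  \<comment> \<open>Two parameters above 2 would have a product above 4.\<close>
  have min2: "min lam \<mu> \<le> 2"
  proof (rule ccontr)
    assume "\<not> ?thesis"
    then have "2 * 2 < lam * \<mu>" by (intro mult_strict_mono) auto
    then show False using lm by simp
  qed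
  have \<beta>0: "\<beta> > 0" using Q(5) by (simp add: \<beta>)
  \<comment> \<open>\<open>\<gamma>\<close> stays positive when \<open>lam = \<mu>\<close>, where
    \<open>\<alpha>\<close> is 0, so the distances to the sets tend to 0 in every case. The bound
    \<open>\<bar>\<alpha>\<bar> \<le> \<gamma>\<close> later brings in
    \<open>\<delta>\<close>.\<close>
  define \<gamma> where "\<gamma> = min \<bar>s - \<tau>\<bar> \<beta>"
  have \<gamma>0: "\<gamma> > 0" using \<tau>(3) \<beta>0 by (simp add: \<gamma>_def)
  have \<alpha>\<gamma>: "\<bar>\<alpha>\<bar> \<le> \<gamma>"
    using \<tau>(1) Q(1,2) by (auto simp: \<gamma>_def \<alpha> \<beta>)
  define w where
    "w = (\<lambda>k. relaxation \<mu> (metric_proj B) (relaxation lam (metric_proj A) (x k)) - x k)"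
  define D where "D = (\<lambda>k. max (infdist (x k) A) (infdist (x k) B))"
  define M where "M = 2 * (1 + \<beta> * sqrt \<nu>)"
  have M0: "M > 0" using \<beta>0 \<nu>0 by (simp add: M_def add_pos_pos)
  have D0: "0 \<le> D k" for k by (simp add: D_def infdist_nonneg max.coboundedI1)
  have "\<exists>e\<ge>0. (\<forall>c\<in>A \<inter> B. e\<^sup>2 \<le> (c - x k) \<bullet> w k) \<and> norm (w k) \<le> sqrt \<nu> * e \<and>
      \<gamma> * min lam \<mu> * D k \<le> M * e" for k
    unfolding w_def D_def M_def
    using \<gamma>0 \<tau>(1) Q(1,2)
    by (intro relaxed_projections_residual[OF assms(1-4) ne l m min2 \<nu>0 Q(3) \<tau>2 \<tau>(2)])
      (auto simp: \<gamma>_def \<beta>)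
  then obtain e where e0: "\<And>k. 0 \<le> e k"
    and e_cutter: "\<And>k c. c \<in> A \<inter> B \<Longrightarrow> (e k)\<^sup>2 \<le> (c - x k) \<bullet> w k"
    and e_w: "\<And>k. norm (w k) \<le> sqrt \<nu> * e k"
    and e_D: "\<And>k. \<gamma> * min lam \<mu> * D k \<le> M * e k"
    by metis
  have w2: "(norm (w k))\<^sup>2 \<le> \<nu> * (e k)\<^sup>2" for k
    using power_mono[OF e_w, of k 2] \<nu>0 by (simp add: power_mult_distrib)
  have decrease: "(norm (x (Suc k) - c))\<^sup>2 \<le> (norm (x k - c))\<^sup>2 - \<epsilon>\<^sup>2 / \<nu> * (e k)\<^sup>2"
    if "c \<in> A \<inter> B" for k c
    using relaxed_step_decrease[OF \<nu>0 assms(11,12) e_cutter[OF that] w2]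
    by (simp add: assms(10) w_def)
  have fej: "fejer_monotone (A \<inter> B) x"
    unfolding fejer_monotone_def
  proof (intro ballI decseq_SucI)
    fix c k assume "c \<in> A \<inter> B"
    then have "(norm (x (Suc k) - c))\<^sup>2 \<le> (norm (x k - c))\<^sup>2"
      using decrease[of c k] \<nu>0 by (smt (verit) divide_nonneg_pos mult_nonneg_nonneg zero_le_power2)
    then show "dist (x (Suc k)) c \<le> dist (x k) c"
      unfolding dist_norm by (rule power2_le_imp_le) simp
  qed
  \<comment> \<open>Regularity is assumed on the ball only; Fejer monotonicity at \<open>z\<close>
    keeps the iterates there.\<close>
  have in_ball: "x k \<in> cball z r" for k
    using fej assms(13) decseqD[of "\<lambda>k. dist (x k) z" 0 k]
    by (auto simp: fejer_monotone_def assms(14) dist_commute simp flip: dist_norm)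
  \<comment> \<open>The distances to \<open>z\<close> converge, so the one-step drops of their
    squares vanish. These drops dominate a fixed multiple of \<open>(e k)\<^sup>2\<close>, and
    \<open>e\<close> dominates \<open>D\<close> up to a constant.\<close>
  have D_lim: "D \<longlonglongrightarrow> 0"
  proof -
    obtain L where L: "(\<lambda>k. dist (x k) z) \<longlonglongrightarrow> L"
      using fejer_monotone_convergent_dist[OF fej assms(13)] by (auto simp: convergent_def)
    have "(\<lambda>k. (dist (x k) z)\<^sup>2 - (dist (x (Suc k)) z)\<^sup>2) \<longlonglongrightarrow> L\<^sup>2 - L\<^sup>2"
      by (intro tendsto_intros L LIMSEQ_Suc[OF L])
    then have "(\<lambda>k. (dist (x k) z)\<^sup>2 - (dist (x (Suc k)) z)\<^sup>2) \<longlonglongrightarrow> 0"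
      by simp
    then have "(\<lambda>k. \<epsilon>\<^sup>2 / \<nu> * (e k)\<^sup>2) \<longlonglongrightarrow> 0"
      using decrease[OF assms(13)] \<nu>0
      by (elim real_tendsto_sandwich[OF _ _ tendsto_const, rotated 2])
        (simp_all add: dist_norm le_diff_eq add.commute)
    from tendsto_mult_left[OF this, of "\<nu> / \<epsilon>\<^sup>2"] have "(\<lambda>k. (e k)\<^sup>2) \<longlonglongrightarrow> 0"
      using \<nu>0 assms(11) by simp
    then have "e \<longlonglongrightarrow> 0"
      using tendsto_real_sqrt e0 by fastforce
    then have "(\<lambda>k. M * e k / (\<gamma> * min lam \<mu>)) \<longlonglongrightarrow> 0"
      by (intro tendsto_divide_zero tendsto_mult_right_zero)
    moreover have "D k \<le> M * e k / (\<gamma> * min lam \<mu>)" for k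
      using e_D[of k] \<gamma>0 l m by (simp add: pos_le_divide_eq mult.commute)
    ultimately show ?thesis
      using D0 by (elim real_tendsto_sandwich[OF _ _ tendsto_const, rotated 2]) simp_all
  qed
  have dA: "(\<lambda>k. infdist (x k) A) \<longlonglongrightarrow> 0" and dB: "(\<lambda>k. infdist (x k) B) \<longlonglongrightarrow> 0"
    by (rule real_tendsto_sandwich[OF _ _ tendsto_const D_lim]; simp add: D_def infdist_nonneg)+
  have weak: "\<exists>xs\<in>A \<inter> B. weakly_converges x xs"
    by (rule fejer_monotone_weakly_converges[OF assms(1-4) ne fej dA dB])
  have strong: "\<exists>xs\<in>A \<inter> B. x \<longlonglongrightarrow> xs \<and> (\<forall>k. dist (x k) xs \<le> 2 * infdist (x k) (A \<inter> B))"
    if "(\<lambda>k. infdist (x k) (A \<inter> B)) \<longlonglongrightarrow> 0"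
    using assms(1,3) by (intro fejer_monotone_converges ne fej that closed_Int)
  have regular: "\<exists>xs\<in>A \<inter> B. x \<longlonglongrightarrow> xs" if "regular_over A B (cball z r)"
    using strong that in_ball D_lim unfolding regular_over_def D_def by blast
  have linear: "\<exists>xs\<in>A \<inter> B. x \<longlonglongrightarrow> xs \<and>
      Q_linear_at_rate x xs (sqrt (1 - (\<epsilon> * \<delta> / (2 * \<nu>))\<^sup>2))"
    if "linearly_regular_over \<kappa> A B (cball z r)"
  proof -
    define d where "d = (\<lambda>k. infdist (x k) (A \<inter> B))"
    have \<kappa>: "\<kappa> > 0" and d_le: "d k \<le> \<kappa> * D k" for k
      using that in_ball by (auto simp: linearly_regular_over_def d_def D_def)
    have d0: "0 \<le> d k" for k by (simp add: d_def infdist_nonneg)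
    \<comment> \<open>Drawn from \<open>D\<close> and not from the rate, which equals 1 when
      \<open>lam = \<mu>\<close> makes \<open>\<delta>\<close> zero.\<close>
    have "d \<longlonglongrightarrow> 0"
      using d0 d_le
      by (intro real_tendsto_sandwich[OF _ _ tendsto_const tendsto_mult_right_zero[OF D_lim, of \<kappa>]]) auto
    then obtain xs where xs: "xs \<in> A \<inter> B" "x \<longlonglongrightarrow> xs" "\<And>k. dist (x k) xs \<le> 2 * d k"
      using strong by (auto simp: d_def)
    have \<delta>0: "0 \<le> \<delta>" by (simp add: assms(18))
    have \<delta>_le: "\<delta> * (d k)\<^sup>2 \<le> (e k)\<^sup>2" for k
    proof -
      have "\<bar>\<alpha>\<bar> * min lam \<mu> * d k \<le> \<bar>\<alpha>\<bar> * min lam \<mu> * (\<kappa> * D k)"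
        using l m d_le by (intro mult_left_mono) auto
      also have "\<dots> \<le> \<gamma> * min lam \<mu> * (\<kappa> * D k)"
        using \<alpha>\<gamma> l m \<kappa> D0 by (intro mult_right_mono) auto
      also have "\<dots> \<le> \<kappa> * (M * e k)"
        using mult_left_mono[OF e_D[of k], of \<kappa>] \<kappa> by (simp add: ac_simps)
      finally have "\<bar>\<alpha>\<bar> * min lam \<mu> / (\<kappa> * M) * d k \<le> e k"
        using \<kappa> M0 by (simp add: field_simps)
      then have "(\<bar>\<alpha>\<bar> * min lam \<mu> / (\<kappa> * M) * d k)\<^sup>2 \<le> (e k)\<^sup>2"
        using \<kappa> M0 d0 l m by (intro power_mono) auto
      moreover have "\<delta> = (\<bar>\<alpha>\<bar> * min lam \<mu> / (\<kappa> * M))\<^sup>2"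
        by (simp add: assms(18) M_def ac_simps)
      ultimately show ?thesis by (metis power_mult_distrib)
    qed
    \<comment> \<open>Cauchy-Schwarz at the projection onto \<open>A \<inter> B\<close> gives
      \<open>(e k)\<^sup>2 \<le> d k * norm (w k)\<close>; combined with \<open>\<delta>_le\<close>,
      one factor \<open>d k\<close> cancels.\<close>
    have \<delta>_w: "\<delta> * d k \<le> norm (w k)" for k
    proof (cases "d k = 0")
      case False
      define p where "p = metric_proj (A \<inter> B) (x k)"
      have "p \<in> A \<inter> B" "norm (x k - p) = d k"
        unfolding p_def d_def using assms(1-4) ne
        by (intro metric_proj_closest closed_Int convex_Int; simp)+
      then have "(e k)\<^sup>2 \<le> d k * norm (w k)"
        using e_cutter[of p k] norm_cauchy_schwarz[of "p - x k" "w k"]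
        by (simp add: norm_minus_commute)
      then have "d k * (\<delta> * d k) \<le> d k * norm (w k)"
        using \<delta>_le[of k] by (simp add: power2_eq_square ac_simps)
      then show ?thesis using False d0[of k] by simp
    qed simp
    \<comment> \<open>In \<open>2 * \<nu>\<close> the 2 comes from
      \<open>dist (x k) xs \<le> 2 * d k\<close>. One factor \<nu> of its square comes from
      \<open>w2\<close>, the other from the guaranteed decrease.\<close>
    have "norm (x (Suc k) - xs) \<le> sqrt (1 - (\<epsilon> * \<delta> / (2 * \<nu>))\<^sup>2) * norm (x k - xs)" for k
    proof -
      have "\<delta> * norm (x k - xs) \<le> 2 * (\<delta> * d k)"
        using mult_left_mono[OF xs(3)[of k] \<delta>0] by (simp add: dist_norm ac_simps)
      also have "\<dots> \<le> 2 * norm (w k)" using \<delta>_w[of k] by simp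
      finally have "(\<delta> * norm (x k - xs))\<^sup>2 \<le> (2 * norm (w k))\<^sup>2"
        using \<delta>0 by (intro power_mono) auto
      then have "(\<delta> * norm (x k - xs))\<^sup>2 \<le> 4 * \<nu> * (e k)\<^sup>2"
        using w2[of k] by (simp add: power_mult_distrib)
      then have "\<epsilon>\<^sup>2 / (4 * \<nu>\<^sup>2) * (\<delta> * norm (x k - xs))\<^sup>2 \<le> \<epsilon>\<^sup>2 / (4 * \<nu>\<^sup>2) * (4 * \<nu> * (e k)\<^sup>2)"
        by (intro mult_left_mono) auto
      also have "\<dots> = \<epsilon>\<^sup>2 / \<nu> * (e k)\<^sup>2"
        using \<nu>0 by (simp add: power2_eq_square field_simps)
      finally have "(\<epsilon> * \<delta> / (2 * \<nu>))\<^sup>2 * (norm (x k - xs))\<^sup>2 \<le> \<epsilon>\<^sup>2 / \<nu> * (e k)\<^sup>2"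
        by (simp add: power_mult_distrib power_divide)
      then have "(norm (x (Suc k) - xs))\<^sup>2 \<le> (1 - (\<epsilon> * \<delta> / (2 * \<nu>))\<^sup>2) * (norm (x k - xs))\<^sup>2"
        using decrease[OF xs(1), of k] by (simp add: left_diff_distrib)
      \<comment> \<open>\<open>sqrt\<close> is multiplicative on all reals, so the sign of the
        factor under the root calls for no case distinction.\<close>
      then have "norm (x (Suc k) - xs) \<le> sqrt ((1 - (\<epsilon> * \<delta> / (2 * \<nu>))\<^sup>2) * (norm (x k - xs))\<^sup>2)"
        by (rule real_le_rsqrt)
      then show ?thesis by (simp add: real_sqrt_mult)
    qed
    then show ?thesis
      using xs(1,2) by (auto simp: Q_linear_at_rate_def)
  qed
  have "\<alpha> \<noteq> 0" if "lam \<noteq> \<mu>"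
  proof
    assume "\<alpha> = 0"
    then have "s\<^sup>2 = t\<^sup>2" by (simp add: \<alpha>)
    then show False using that by (simp add: Q(3,4))
  qed
  then show ?thesis
    using weak regular linear \<beta>0 by blast
qed

end
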